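(* Let $q=3^h$ ($h\ge 1$), and let $\Pi_q$ be a projective plane of order $q$ represented by a planar function $f:\mathrm{GF}(q)\to\mathrm{GF}(q)$. Then \[\overline{\chi}_b(\Pi_q)=\left\lfloor\frac{q^2+q+1}{3}\right\rfloor=\frac{q^2+q}{3}.\]
   Context: For a hypergraph with vertex set $V$ and edge set $E$, a strict $N$-coloring is a partition of $V$ into exactly $N$ nonempty color classes. An edge is rainbow if no two of its vertices have the same color. A coloring is proper (rainbow-free) if no edge is rainbow, and balanced if the sizes of any two color classes differ by at most one. The balanced upper chromatic number $\overline{\chi}_b$ of a hypergraph is the largest $N$ such that it admits a proper strict balanced $N$-coloring. A projective (or affine) plane is regarded as the hypergraph whose vertices are the points and whose edges are the lines. A function $f:\mathrm{GF}(q)\to\mathrm{GF}(q)$ is a planar function if for every $a\neq 0$ and every $b\in\mathrm{GF}(q)$ the equation $f(x+a)-f(x)=b$ has a unique solution $x$. The affine plane represented by $f$ has point set $\mathrm{GF}(q)^2$; its lines are the vertical lines $\{(c,y):y\in\mathrm{GF}(q)\}$, $c\in\mathrm{GF}(q)$, and the translates $\{(x+a,f(x)+b):x\in\mathrm{GF}(q)\}$, $a,b\in\mathrm{GF}(q)$, of the graph of $f$. Its parallel classes are the vertical lines, and for each $a$ the translates with that $a$ (differing by vertical translations). The projective plane represented by $f$ is its projective closure: one ideal point is added to each parallel class, and the ideal line consists of all ideal points. *)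

theory Defs
  imports Complex_Main "HOL-Library.Disjoint_Sets" "HOL-Library.Cardinality"
begin

definition strict_coloring :: "'v set \<Rightarrow> nat \<Rightarrow> 'v set set \<Rightarrow> bool" where
  "strict_coloring V N P \<longleftrightarrow> partition_on V P \<and> finite P \<and> card P = N"

definition rainbow :: "'v set set \<Rightarrow> 'v set \<Rightarrow> bool" where
  "rainbow P e \<longleftrightarrow> (\<forall>x\<in>e. \<forall>y\<in>e. x \<noteq> y \<longrightarrow> \<not> (\<exists>C\<in>P. x \<in> C \<and> y \<in> C))"

definition proper_coloring :: "'v set set \<Rightarrow> 'v set set \<Rightarrow> bool" where
  "proper_coloring E P \<longleftrightarrow> (\<forall>e\<in>E. \<not> rainbow P e)"

definition balanced_coloring :: "'v set set \<Rightarrow> bool" where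
  "balanced_coloring P \<longleftrightarrow> (\<forall>C\<in>P. \<forall>D\<in>P. \<bar>int (card C) - int (card D)\<bar> \<le> 1)"

text \<open>
  The maximum is meaningful only if the admissible values of \<open>N\<close> are bounded and at least one
  exists; for finite \<open>V\<close> they are bounded by \<open>card V\<close>.
\<close>

definition balanced_upper_chromatic_number :: "'v set \<Rightarrow> 'v set set \<Rightarrow> nat" where
  "balanced_upper_chromatic_number V E =
     (GREATEST N. \<exists>P. strict_coloring V N P \<and> proper_coloring E P \<and> balanced_coloring P)"

definition planar_function :: "('a::field \<Rightarrow> 'a) \<Rightarrow> bool" where
  "planar_function f \<longleftrightarrow> (\<forall>a b. a \<noteq> 0 \<longrightarrow> (\<exists>!x. f (x + a) - f x = b))"

definition vertical_line :: "'a \<Rightarrow> ('a \<times> 'a) set" where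
  "vertical_line c = {(c, y) |y. True}"

definition graph_translate :: "('a::field \<Rightarrow> 'a) \<Rightarrow> 'a \<Rightarrow> 'a \<Rightarrow> ('a \<times> 'a) set" where
  "graph_translate f a b = {(x + a, f x + b) |x. True}"

definition parallel_classes :: "('a::field \<Rightarrow> 'a) \<Rightarrow> ('a \<times> 'a) set set set" where
  "parallel_classes f = insert (range vertical_line) (range (\<lambda>a. range (graph_translate f a)))"

text \<open>
  Projective closure of an affine plane with point set \<open>X\<close> whose lines are partitioned into the
  parallel classes \<open>\<C>\<close>: affine points are tagged with \<open>Inl\<close>, and the ideal point of a parallel
  class \<open>c\<close> is \<open>Inr c\<close>.
\<close>

definition closure_points :: "'p set \<Rightarrow> 'p set set set \<Rightarrow> ('p + 'p set set) set" where
  "closure_points X \<C> = Inl ` X \<union> Inr ` \<C>"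

definition closure_lines :: "'p set set set \<Rightarrow> ('p + 'p set set) set set" where
  "closure_lines \<C> = insert (Inr ` \<C>) {insert (Inr c) (Inl ` l) |c l. c \<in> \<C> \<and> l \<in> c}"

definition plane_points :: "('a::field \<Rightarrow> 'a) \<Rightarrow> ('a \<times> 'a + ('a \<times> 'a) set set) set" where
  "plane_points f = closure_points UNIV (parallel_classes f)"

definition plane_lines :: "('a::field \<Rightarrow> 'a) \<Rightarrow> ('a \<times> 'a + ('a \<times> 'a) set set) set set" where
  "plane_lines f = closure_lines (parallel_classes f)"

end

theory Submission
  imports Defs
begin

text \<open>
  The classes of a balanced coloring with more than a third of \<open>card V\<close> colors have at most three
  points, one of them at most two, so there are fewer than \<open>card V\<close> monochromatic pairs; but distinct
  lines need distinct monochromatic pairs, and there are as many lines as points.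

  For the construction, pick \<open>c\<close> with \<open>f (c + 1) = f c\<close>. The line with parameters \<open>a, b\<close> contains
  \<open>(a + c, y)\<close> and \<open>(a + c + 1, y)\<close> for \<open>y = b + f c\<close>. So, in characteristic 3, the horizontal
  triples \<open>{(x, y), (x + 1, y), (x + 2, y)}\<close> take care of every non-vertical line. Omitting the
  triples on the rows \<open>y = 0\<close> and \<open>y = 1\<close> loses just the two lines through \<open>(a + c, 0)\<close> and
  \<open>(a + c, 1)\<close> in each direction \<open>a\<close>, and they are recovered by coloring these two points like the
  ideal point of \<open>a\<close>; this also serves all vertical lines. The vertical ideal point joins one of
  these classes, which serves the ideal line.
\<close>

section \<open>The upper bound\<close>

lemma sum_card_partition_on:
  assumes "finite V" "partition_on V P"
  shows "(\<Sum>C\<in>P. card C) = card V"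
proof -
  have "finite C" if "C \<in> P" for C
    using assms that by (metis Union_upper finite_subset partition_onD1)
  then show ?thesis
    using card_Union_disjoint[of P] assms by (simp add: partition_on_def)
qed

text \<open>Double counting of monochromatic pairs: a class of size \<open>k \<le> 3\<close> carries
  \<open>k choose 2 \<le> k\<close> pairs, strictly fewer when \<open>k\<close> is 1 or 2, while
  each edge claims a pair of its own.\<close>

lemma card_balanced_proper_coloring_le:
  assumes "finite V"
    and linear: "\<And>l m u v. \<lbrakk>l \<in> E; m \<in> E; u \<noteq> v; {u, v} \<subseteq> l; {u, v} \<subseteq> m\<rbrakk> \<Longrightarrow> l = m"
    and many: "card V \<le> card E"
    and part: "partition_on V P" and proper: "proper_coloring E P" and balanced: "balanced_coloring P"
  shows "3 * card P \<le> card V"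
proof (rule ccontr)
  assume "\<not> ?thesis"
  \<comment> \<open>The mean class size is below 3, so some class \<open>C0\<close> has at most two
    points; balance then caps every class at 3.\<close>
  then have lt: "(\<Sum>C\<in>P. card C) < (\<Sum>C\<in>P. 3)"
    using sum_card_partition_on[OF \<open>finite V\<close> part] by simp
  then obtain C0 where C0: "C0 \<in> P" "card C0 < 3"
    by (meson linorder_not_less sum_mono)
  have finP: "finite P" using part \<open>finite V\<close> by (simp add: finite_elements)
  have finC: "finite C" if "C \<in> P" for C
    using part \<open>finite V\<close> that by (metis Union_upper finite_subset partition_onD1)
  have le3: "card C \<le> 3" if "C \<in> P" for C
  proof -
    have "\<bar>int (card C) - int (card C0)\<bar> \<le> 1"
      using balanced C0(1) that unfolding balanced_coloring_def by blast
    then show ?thesis using C0(2) by linarith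
  qed
  have pairs_le: "card C choose 2 \<le> card C" if "C \<in> P" for C
  proof -
    have "card C \<in> {0, 1, 2, 3}" using le3[OF that] by auto
    then show ?thesis by (auto simp: numeral_eq_Suc)
  qed
  \<comment> \<open>Strictness needs a nonempty class: \<open>k choose 2 < k\<close> fails at
    \<open>k = 0\<close>.\<close>
  have "card C0 \<noteq> 0"
    using finC[OF C0(1)] part C0(1) by (auto simp: partition_on_def)
  then have "card C0 \<in> {1, 2}" using C0(2) by auto
  then have pairs_less: "card C0 choose 2 < card C0" by (auto simp: numeral_eq_Suc)
  define M where "M = (\<Union>C\<in>P. {s. s \<subseteq> C \<and> card s = 2})"
  have "card M \<le> (\<Sum>C\<in>P. card {s. s \<subseteq> C \<and> card s = 2})"
    unfolding M_def using finP by (rule card_UN_le)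
  also have "\<dots> = (\<Sum>C\<in>P. card C choose 2)"
    using finC by (intro sum.cong refl) (rule n_subsets)
  also have "\<dots> < (\<Sum>C\<in>P. card C)"
    by (rule sum_strict_mono_ex1[OF finP]) (use pairs_le pairs_less C0(1) in auto)
  finally have "card M < card V"
    using sum_card_partition_on[OF \<open>finite V\<close> part] by simp
  have "\<exists>s. s \<subseteq> e \<and> s \<in> M" if "e \<in> E" for e
  proof -
    have "\<not> rainbow P e" using proper that by (simp add: proper_coloring_def)
    then obtain u v C where uv: "u \<in> e" "v \<in> e" "u \<noteq> v" "C \<in> P" "u \<in> C" "v \<in> C"
      unfolding rainbow_def by auto
    then have "{u, v} \<in> M" unfolding M_def by (intro UN_I[of C]) auto
    with uv show ?thesis by (intro exI[of _ "{u, v}"]) simp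
  qed
  then have "\<forall>e\<in>E. \<exists>s. s \<subseteq> e \<and> s \<in> M" by blast
  from bchoice[OF this] obtain p
    where p: "\<And>e. e \<in> E \<Longrightarrow> p e \<subseteq> e" "\<And>e. e \<in> E \<Longrightarrow> p e \<in> M"
    by auto
  \<comment> \<open>A pair chosen by two edges lies in both, so linearity identifies them.\<close>
  have "inj_on p E"
  proof (rule inj_onI)
    fix l m assume lm: "l \<in> E" "m \<in> E" "p l = p m"
    have "card (p l) = 2" using p(2)[OF lm(1)] by (auto simp: M_def)
    then obtain u v where "p l = {u, v}" "u \<noteq> v" by (auto simp: card_2_iff)
    moreover have "p l \<subseteq> l" "p l \<subseteq> m"
      using p(1)[OF lm(1)] p(1)[OF lm(2)] lm(3) by simp_all
    ultimately show "l = m" using linear[OF lm(1,2)] by simp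
  qed
  moreover have "finite M" unfolding M_def using finP finC by auto
  ultimately have "card E \<le> card M" using p(2) by (intro card_inj_on_le) auto
  with \<open>card M < card V\<close> many show False by simp
qed

section \<open>The plane of a planar function\<close>

abbreviation vertical_class :: "('a \<times> 'a) set set" where
  "vertical_class \<equiv> range vertical_line"

abbreviation slope_class :: "('a::field \<Rightarrow> 'a) \<Rightarrow> 'a \<Rightarrow> ('a \<times> 'a) set set" where
  "slope_class f a \<equiv> range (graph_translate f a)"

lemma mem_vertical_line [simp]: "(u, v) \<in> vertical_line c \<longleftrightarrow> u = c"
  by (auto simp: vertical_line_def)

lemma mem_graph_translate [simp]: "(u, v) \<in> graph_translate f a b \<longleftrightarrow> v = f (u - a) + b"
  by (auto simp: graph_translate_def intro: exI[of _ "u - a"])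

lemma vertical_line_inject [simp]: "vertical_line c = vertical_line c' \<longleftrightarrow> c = c'"
  by (metis mem_vertical_line)

lemma graph_translate_neq_vertical [simp]: "graph_translate f a b \<noteq> vertical_line c"
proof
  assume "graph_translate f a b = vertical_line c"
  then have "(c, 0) \<in> graph_translate f a b" "(c, 1) \<in> graph_translate f a b" by simp_all
  then show False by simp
qed

lemma slope_class_neq_vertical [simp]:
  "slope_class f a \<noteq> vertical_class" "vertical_class \<noteq> slope_class f a"
  by (metis graph_translate_neq_vertical rangeE rangeI)+

lemma planar_function_unique:
  assumes "planar_function f" "a \<noteq> 0" "f (x + a) - f x = f (y + a) - f y"
  shows "x = y"
  using assms unfolding planar_function_def by metis

text \<open>At a common point of abscissa \<open>u\<close>, the value \<open>w = u - a\<close>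
  solves \<open>f (w + (a - a')) - f w = b - b'\<close>, and planarity makes the solution
  unique.\<close>

lemma graph_translates_meet_once:
  assumes f: "planar_function f" and ne: "a \<noteq> a'"
    and "f (u - a) + b = f (u - a') + b'" "f (v - a) + b = f (v - a') + b'"
  shows "u = v"
proof -
  have "t - s = b - b'" if "s + b = t + b'" for s t
  proof -
    have "t - s = (t + b') - (s + b')" by simp
    also have "\<dots> = (s + b) - (s + b')" using that by simp
    finally show ?thesis by simp
  qed
  note eq = this[OF assms(3)] this[OF assms(4)]
  have "u - a = v - a"
    by (rule planar_function_unique[OF f, of "a - a'"]) (use ne eq in simp_all)
  then show ?thesis by simp
qed

lemma graph_translate_inject:
  assumes f: "planar_function f"
  shows "graph_translate f a b = graph_translate f a' b' \<longleftrightarrow> a = a' \<and> b = b'"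
proof
  assume eq: "graph_translate f a b = graph_translate f a' b'"
  have *: "f (u - a) + b = f (u - a') + b'" for u
    using eq by (metis mem_graph_translate)
  \<comment> \<open>Equal translates share the abscissas 0 and 1, one too many for different
    directions.\<close>
  have "a = a'"
    using graph_translates_meet_once[OF f _ *[of 0] *[of 1]] by auto
  with * show "a = a' \<and> b = b'" by simp
qed simp

lemma slope_class_inject [simp]:
  assumes "planar_function f"
  shows "slope_class f a = slope_class f a' \<longleftrightarrow> a = a'"
proof
  assume "slope_class f a = slope_class f a'"
  then have "graph_translate f a 0 \<in> slope_class f a'" by blast
  then show "a = a'" by (auto simp: graph_translate_inject[OF assms])
qed simp

section \<open>Points and lines of the projective closure\<close>

abbreviation closed_vertical :: "'a \<Rightarrow> ('a \<times> 'a + ('a \<times> 'a) set set) set" where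
  "closed_vertical c \<equiv> insert (Inr vertical_class) (Inl ` vertical_line c)"

text \<open>Both parameters sit in one pair so that these lines form a single \<open>range\<close>,
  counted by injectivity.\<close>

abbreviation closed_graph ::
    "('a::field \<Rightarrow> 'a) \<Rightarrow> 'a \<times> 'a \<Rightarrow> ('a \<times> 'a + ('a \<times> 'a) set set) set" where
  "closed_graph f p \<equiv>
     insert (Inr (slope_class f (fst p))) (Inl ` graph_translate f (fst p) (snd p))"

lemma plane_points_eq:
  "plane_points f = range Inl \<union> {Inr vertical_class} \<union> range (\<lambda>a. Inr (slope_class f a))"
  by (auto simp: plane_points_def closure_points_def parallel_classes_def)

lemma plane_lines_eq:
  "plane_lines f =
     insert (Inr ` parallel_classes f) (range closed_vertical \<union> range (closed_graph f))"
proof -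
  have "{insert (Inr C) (Inl ` l) |C l. C \<in> parallel_classes f \<and> l \<in> C}
      = range closed_vertical \<union> range (closed_graph f)"
    (is "?L = ?R")
  proof
    have "insert (Inr (slope_class f a)) (Inl ` graph_translate f a b) \<in> range (closed_graph f)"
      for a b
      by (rule range_eqI[of _ _ "(a, b)"]) simp
    then show "?L \<subseteq> ?R"
      unfolding parallel_classes_def by blast
    show "?R \<subseteq> ?L"
      unfolding parallel_classes_def by blast
  qed
  then show ?thesis by (simp add: plane_lines_def closure_lines_def)
qed

lemma plane_lines_cases [consumes 1, case_names ideal vertical graph]:
  assumes "l \<in> plane_lines f"
  obtains "l = Inr ` parallel_classes f" | c where "l = closed_vertical c"
    | a b where "l = closed_graph f (a, b)"
  using assms unfolding plane_lines_eq by auto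

lemma card_plane_points:
  fixes f :: "'a::{field, finite} \<Rightarrow> 'a"
  assumes "planar_function f"
  shows "card (plane_points f) = CARD('a) ^ 2 + CARD('a) + 1"
proof -
  let ?A = "range (Inl :: 'a \<times> 'a \<Rightarrow> 'a \<times> 'a + ('a \<times> 'a) set set)"
  let ?B = "range (\<lambda>a. Inr (slope_class f a) :: 'a \<times> 'a + ('a \<times> 'a) set set)"
  have "card ?A = CARD('a) ^ 2"
    by (simp add: card_image card_prod power2_eq_square)
  moreover have "card ?B = CARD('a)"
    using assms by (simp add: card_image inj_def)
  moreover have "card (?A \<union> ?B) = card ?A + card ?B"
    by (intro card_Un_disjoint) auto
  moreover have "plane_points f = insert (Inr vertical_class) (?A \<union> ?B)"
    by (auto simp: plane_points_eq)
  moreover have "Inr vertical_class \<notin> ?A \<union> ?B" by auto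
  ultimately show ?thesis by simp
qed

text \<open>Lines of the closure are told apart by their affine points; the ideal line has
  none.\<close>

lemma affine_part:
  "Inl -` closed_vertical c = vertical_line c"
  "Inl -` closed_graph f p = graph_translate f (fst p) (snd p)"
  "Inl -` Inr ` A = {}"
  by auto

lemma card_plane_lines:
  fixes f :: "'a::{field, finite} \<Rightarrow> 'a"
  assumes "planar_function f"
  shows "card (plane_lines f) = CARD('a) ^ 2 + CARD('a) + 1"
proof -
  have ne: "closed_vertical c \<noteq> closed_graph f p" for p c
    by (metis affine_part graph_translate_neq_vertical)
  have inj_v: "inj (closed_vertical :: 'a \<Rightarrow> _)"
    by (rule injI) (metis affine_part(1) vertical_line_inject)
  have inj_g: "inj (closed_graph f)"
  proof (rule injI)
    fix p p' assume "closed_graph f p = closed_graph f p'"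
    then have "graph_translate f (fst p) (snd p) = graph_translate f (fst p') (snd p')"
      by (metis affine_part(2))
    then show "p = p'" by (simp add: graph_translate_inject[OF assms] prod_eq_iff)
  qed
  have "card (range (closed_vertical :: 'a \<Rightarrow> _)) = CARD('a)"
    using inj_v by (rule card_image)
  moreover have "card (range (closed_graph f)) = CARD('a) ^ 2"
    using card_image[OF inj_g] by (simp add: card_prod power2_eq_square)
  moreover have "range closed_vertical \<inter> range (closed_graph f) = {}"
  proof (rule equals0I)
    fix X assume "X \<in> range closed_vertical \<inter> range (closed_graph f)"
    then obtain c p where "X = closed_vertical c" "X = closed_graph f p"
      by (elim IntE rangeE)
    then show False using ne by metis
  qed
  then have "card (range closed_vertical \<union> range (closed_graph f))
      = card (range (closed_vertical :: 'a \<Rightarrow> _)) + card (range (closed_graph f))"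
    by (intro card_Un_disjoint) auto
  moreover have "Inr ` parallel_classes f \<notin> range closed_vertical \<union> range (closed_graph f)"
  proof -
    have "vertical_line c \<noteq> {}" "graph_translate f a b \<noteq> {}" for a b c :: 'a
      by (auto simp: vertical_line_def graph_translate_def)
    then have "Inr ` parallel_classes f \<noteq> closed_vertical c"
      "Inr ` parallel_classes f \<noteq> closed_graph f p" for c p
      by (metis affine_part(1,3), metis affine_part(2,3))
    then show ?thesis by (meson UnE rangeE)
  qed
  ultimately show ?thesis by (simp add: plane_lines_eq)
qed

lemma plane_lines_linear:
  assumes f: "planar_function f"
    and l: "l \<in> plane_lines f" and m: "m \<in> plane_lines f"
    and "u \<noteq> v" "{u, v} \<subseteq> l" "{u, v} \<subseteq> m"
  shows "l = m"
proof -
  have graphs: "l = m" if l: "l = closed_graph f (a, b)" and m: "m = closed_graph f (a', b')"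
    for a b a' b'
  proof (cases "a = a'")
    case True
    \<comment> \<open>A graph line has only one ideal point, so one of the two shared points is
      affine, and it determines \<open>b\<close>.\<close>
    have "\<exists>x y. Inl (x, y) \<in> l \<and> Inl (x, y) \<in> m"
      using \<open>u \<noteq> v\<close> \<open>{u, v} \<subseteq> l\<close> \<open>{u, v} \<subseteq> m\<close> unfolding l m by auto
    then have "b = b'" using True unfolding l m by auto
    then show ?thesis using True l m by simp
  next
    case False
    \<comment> \<open>The ideal points of \<open>l\<close> and \<open>m\<close> differ, so both
      shared points are affine.\<close>
    then have "u \<in> Inl ` graph_translate f a b" "v \<in> Inl ` graph_translate f a b"
      "u \<in> Inl ` graph_translate f a' b'" "v \<in> Inl ` graph_translate f a' b'"
      using \<open>{u, v} \<subseteq> l\<close> \<open>{u, v} \<subseteq> m\<close> slope_class_inject[OF f] unfolding l m by auto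
    then obtain x y where "u = Inl (x, f (x - a) + b)" "v = Inl (y, f (y - a) + b)"
      "f (x - a) + b = f (x - a') + b'" "f (y - a) + b = f (y - a') + b'"
      by auto
    then show ?thesis
      using graph_translates_meet_once[OF f False, of x b b' y] \<open>u \<noteq> v\<close> by simp
  qed
  from l show ?thesis
  proof (cases rule: plane_lines_cases)
    case l: ideal
    from m show ?thesis by (cases rule: plane_lines_cases) (use l assms in auto)
  next
    case l: vertical
    from m show ?thesis by (cases rule: plane_lines_cases) (use l assms in auto)
  next
    case l: graph
    from m show ?thesis
    proof (cases rule: plane_lines_cases)
      case ideal
      then show ?thesis using l assms by auto
    next
      case vertical
      then show ?thesis using l assms by auto
    next
      case graph
      with l show ?thesis by (rule graphs)
    qed
  qed
qed

section \<open>The coloring\<close>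

text \<open>Translation by 1 permutes the ring, so adding 1 to every summand leaves the sum of all
  elements unchanged.\<close>

lemma of_nat_CARD_eq_0: "of_nat CARD('a::{ring_1, finite}) = (0::'a)"
proof -
  have "(\<Sum>x\<in>UNIV. x + 1) = (\<Sum>x\<in>UNIV. x :: 'a)"
    by (rule sum.reindex_bij_witness[of _ "\<lambda>x. x - 1" "\<lambda>x. x + 1"]) auto
  then show ?thesis by (simp add: sum.distrib)
qed

text \<open>In characteristic 3 this is a horizontal coset of the prime field, so each of its three
  points generates the same triple.\<close>

definition triple :: "'a::field \<times> 'a \<Rightarrow> ('a \<times> 'a + 'b) set" where
  "triple p = {Inl p, Inl (fst p + 1, snd p), Inl (fst p + 2, snd p)}"

text \<open>Direction 0 is an arbitrary choice for hosting the vertical ideal point; the resulting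
  class of size 4 absorbs the remainder of the number of points modulo 3.\<close>

definition ideal_color ::
    "('a::field \<Rightarrow> 'a) \<Rightarrow> 'a \<Rightarrow> 'a \<Rightarrow> ('a \<times> 'a + ('a \<times> 'a) set set) set" where
  "ideal_color f c a = {Inr (slope_class f a), Inl (a + c, 0), Inl (a + c, 1)}
     \<union> (if a = 0 then {Inr vertical_class} else {})"

definition plane_coloring ::
    "('a::field \<Rightarrow> 'a) \<Rightarrow> 'a \<Rightarrow> ('a \<times> 'a + ('a \<times> 'a) set set) set set" where
  "plane_coloring f c = range (ideal_color f c) \<union> triple ` {p. snd p \<notin> {0, 1}}"

section \<open>Verification of the coloring in characteristic 3\<close>

context
  fixes f :: "'a::field \<Rightarrow> 'a" and c :: 'a
  assumes f: "planar_function f" and char3: "(3::'a) = 0" and c: "f (c + 1) = f c"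
begin

lemma two_char3: "(2::'a) = - 1"
  using char3 by (metis add_eq_0_iff add.commute one_plus_numeral one_add_one
      semiring_norm(3) numeral_plus_one)

lemma neg_one_char3: "(- 1::'a) \<noteq> 1"
  using two_char3 by (metis add_cancel_right_right one_add_one zero_neq_one)

text \<open>Replacing the offset 2 by -1 makes the set of offsets visibly symmetric.\<close>

lemma triple_eq: "triple p = {Inl p, Inl (fst p + 1, snd p), Inl (fst p - 1, snd p :: 'a)}"
  unfolding triple_def two_char3 by simp

lemma mem_triple:
  "r \<in> triple p \<longleftrightarrow> (\<exists>q. r = Inl q \<and> snd q = snd p \<and> (fst q - fst p) \<in> {0, 1, -1 :: 'a})"
  by (auto simp: triple_eq prod_eq_iff algebra_simps)

text \<open>The offsets form the prime field, which is closed under subtraction: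
  \<open>1 - (-1) = 2 = -1\<close>.\<close>

lemma diff_triple_trans:
  assumes "x - z \<in> {0, 1, -1 :: 'a}" "y - z \<in> {0, 1, -1}"
  shows "x - y \<in> {0, 1, -1}"
proof -
  obtain d e where "x = z + d" "y = z + e" and de: "d \<in> {0, 1, -1}" "e \<in> {0, 1, -1}"
    using assms by (metis diff_add_cancel add.commute)
  then have "x - y = d - e" by simp
  with de show ?thesis by (auto simp: two_char3)
qed

text \<open>Lying in the same row at a difference in \<open>{0, 1, -1}\<close> is an equivalence
  relation, and triples are its classes.\<close>

lemma triple_disjnt:
  "triple p = (triple p' :: ('a \<times> 'a + 'b) set) \<or>
    triple p \<inter> triple p' = ({} :: ('a \<times> 'a + 'b) set)"
proof (rule disjCI)
  assume "triple p \<inter> triple p' \<noteq> ({} :: ('a \<times> 'a + 'b) set)"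
  then obtain r :: "'a \<times> 'a + 'b" where "r \<in> triple p" "r \<in> triple p'" by blast
  then obtain q where q: "snd q = snd p" "snd q = snd p'"
    "fst q - fst p \<in> {0, 1, -1}" "fst q - fst p' \<in> {0, 1, -1}"
    unfolding mem_triple by (metis sum.inject(1))
  have sym: "y - x \<in> {0, 1, -1 :: 'a}" if "x - y \<in> {0, 1, -1}" for x y
    using diff_triple_trans[of y y x] diff_triple_trans[of y x y] that by (auto simp: algebra_simps)
  have "x - fst p \<in> {0, 1, -1} \<longleftrightarrow> x - fst p' \<in> {0, 1, -1}" for x
    using q(3,4) sym diff_triple_trans by meson
  then show "triple p = (triple p' :: ('a \<times> 'a + 'b) set)"
    using q(1,2) by (simp add: set_eq_iff mem_triple)
qed

lemma card_triple: "card (triple p :: ('a \<times> 'a + 'b) set) = 3"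
  using neg_one_char3
  by (auto simp: triple_eq prod_eq_iff card_insert_if eq_neg_iff_add_eq_0 algebra_simps)

lemma card_ideal_color: "card (ideal_color f c a) = (if a = 0 then 4 else 3)"
  using f by (auto simp: ideal_color_def card_insert_if)

lemma ideal_color_disjnt: "a \<noteq> a' \<Longrightarrow> ideal_color f c a \<inter> ideal_color f c a' = {}"
  using f by (auto simp: ideal_color_def split: if_splits)

lemma partition_on_plane_coloring: "partition_on (plane_points f) (plane_coloring f c)"
proof (rule partition_onI)
  show "\<Union> (plane_coloring f c) = plane_points f"
  proof
    show "\<Union> (plane_coloring f c) \<subseteq> plane_points f"
      by (auto simp: plane_coloring_def ideal_color_def plane_points_eq triple_def split: if_splits)
    have "Inl (x, y) \<in> \<Union> (plane_coloring f c)" for x y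
    proof (cases "y \<in> {0, 1}")
      case True
      \<comment> \<open>The direction \<open>a\<close> is found by solving
        \<open>a + c = x\<close>.\<close>
      then have "Inl (x, y) \<in> ideal_color f c (x - c)" by (auto simp: ideal_color_def)
      then show ?thesis by (auto simp: plane_coloring_def)
    next
      case False
      then have "triple (x, y) \<in> plane_coloring f c" by (auto simp: plane_coloring_def)
      then show ?thesis by (rule UnionI) (simp add: triple_def)
    qed
    moreover have "Inr (slope_class f a) \<in> ideal_color f c a" for a
      by (simp add: ideal_color_def)
    then have "Inr (slope_class f a) \<in> \<Union> (plane_coloring f c)" for a
      by (auto simp: plane_coloring_def)
    moreover have "Inr vertical_class \<in> ideal_color f c 0" by (simp add: ideal_color_def)
    then have "Inr vertical_class \<in> \<Union> (plane_coloring f c)" by (auto simp: plane_coloring_def)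
    ultimately show "plane_points f \<subseteq> \<Union> (plane_coloring f c)"
      by (auto simp: plane_points_eq)
  qed
next
  have mixed: "ideal_color f c a \<inter> triple p = {}" if "snd p \<notin> {0, 1}" for a p
    using that by (auto simp: ideal_color_def triple_def)
  show "disjnt C D" if "C \<in> plane_coloring f c" "D \<in> plane_coloring f c" "C \<noteq> D" for C D
    using that ideal_color_disjnt triple_disjnt mixed unfolding plane_coloring_def disjnt_def
    by (smt (verit) Int_commute UnE image_iff mem_Collect_eq)
next
  show "{} \<notin> plane_coloring f c"
    by (auto simp: plane_coloring_def triple_def ideal_color_def)
qed

lemma balanced_plane_coloring: "balanced_coloring (plane_coloring f c)"
proof -
  have card: "3 \<le> card C \<and> card C \<le> 4" if "C \<in> plane_coloring f c" for C
    using that by (auto simp: plane_coloring_def card_triple card_ideal_color)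
  show ?thesis
    unfolding balanced_coloring_def
  proof (intro ballI)
    fix C D assume "C \<in> plane_coloring f c" "D \<in> plane_coloring f c"
    then show "\<bar>int (card C) - int (card D)\<bar> \<le> 1"
      using card[of C] card[of D] by linarith
  qed
qed

lemma proper_plane_coloring: "proper_coloring (plane_lines f) (plane_coloring f c)"
proof -
  have witness: "\<not> rainbow (plane_coloring f c) l"
    if "u \<in> l" "v \<in> l" "u \<noteq> v" "C \<in> plane_coloring f c" "u \<in> C" "v \<in> C" for u v l C
    using that unfolding rainbow_def by blast
  have ideal: "ideal_color f c a \<in> plane_coloring f c" for a
    by (simp add: plane_coloring_def)
  have "\<not> rainbow (plane_coloring f c) (Inr ` parallel_classes f)"
    by (rule witness[OF _ _ _ ideal[of 0], of "Inr vertical_class" _ "Inr (slope_class f 0)"])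
       (auto simp: ideal_color_def parallel_classes_def)
  moreover have "\<not> rainbow (plane_coloring f c) (closed_vertical x)" for x
    by (rule witness[OF _ _ _ ideal[of "x - c"], of "Inl (x, 0)" _ "Inl (x, 1)"])
       (auto simp: ideal_color_def)
  moreover have "\<not> rainbow (plane_coloring f c) (closed_graph f (a, b))" for a b
  \<comment> \<open>The line has height \<open>f c + b\<close> at abscissa \<open>a + c\<close>. In
    rows 0 and 1 that point is colored like the ideal point of the line; in other rows it shares a
    triple with its right neighbor, also on the line.\<close>
  proof (cases "f c + b \<in> {0, 1}")
    case True
    show ?thesis
      by (rule witness[OF _ _ _ ideal[of a], of "Inl (a + c, f c + b)" _ "Inr (slope_class f a)"])
         (use True in \<open>auto simp: ideal_color_def image_iff\<close>)
  next
    case False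
    then have "triple (a + c, f c + b) \<in> plane_coloring f c"
      by (auto simp: plane_coloring_def)
    moreover have "f (a + c + 1 - a) = f c" using c by (simp add: algebra_simps)
    ultimately show ?thesis
      by (intro witness[of "Inl (a + c, f c + b)" _ "Inl (a + c + 1, f c + b)"])
         (auto simp: triple_def image_iff)
  qed
  ultimately show ?thesis by (auto simp: proper_coloring_def plane_lines_eq)
qed

text \<open>One class has size 4 and all others size 3.\<close>

lemma card_plane_coloring:
  assumes fin: "finite (plane_points f)"
  shows "card (plane_points f) = 3 * card (plane_coloring f c) + 1"
proof -
  let ?P = "plane_coloring f c" and ?C0 = "ideal_color f c 0"
  have finP: "finite ?P" using finite_elements[OF fin partition_on_plane_coloring] .
  have C0: "?C0 \<in> ?P" by (simp add: plane_coloring_def)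
  have "card C = 3" if "C \<in> ?P - {?C0}" for C
    using that by (auto simp: plane_coloring_def card_triple card_ideal_color split: if_splits)
  then have "(\<Sum>C\<in>?P. card C) = 4 + 3 * card (?P - {?C0})"
    using finP C0 by (simp add: sum.remove card_ideal_color)
  moreover have "card ?P = Suc (card (?P - {?C0}))"
    using finP C0 by (rule card.remove)
  ultimately show ?thesis
    using sum_card_partition_on[OF fin partition_on_plane_coloring] by simp
qed

end

theorem theorem2:
  fixes f :: "'a::{field, finite} \<Rightarrow> 'a" and h q :: nat
  assumes "h \<ge> 1" and "q = 3 ^ h"
    and "CARD('a) = q"
    and "planar_function f"
  shows "int (balanced_upper_chromatic_number (plane_points f) (plane_lines f))
           = \<lfloor>real (q ^ 2 + q + 1) / 3\<rfloor>
       \<and> real_of_int \<lfloor>real (q ^ 2 + q + 1) / 3\<rfloor> = real (q ^ 2 + q) / 3"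
proof -
  \<comment> \<open>The field has \<open>3 ^ h\<close> elements, and this number vanishes in it; a
    field has no nilpotents, so 3 vanishes too.\<close>
  have "(3::'a) ^ h = 0"
    using of_nat_CARD_eq_0[where 'a = 'a] assms(2,3) by simp
  then have char3: "(3::'a) = 0" by simp
  \<comment> \<open>Planarity with shift 1 and value 0.\<close>
  obtain c where "f (c + 1) - f c = 0"
    using \<open>planar_function f\<close> unfolding planar_function_def by (metis zero_neq_one)
  then have c: "f (c + 1) = f c" by simp
  let ?N = "card (plane_coloring f c)"
  have fin: "finite (plane_points f)"
    by (simp add: plane_points_eq)
  have points: "card (plane_points f) = q ^ 2 + q + 1"
    using card_plane_points assms(3,4) by blast
  then have N: "3 * ?N = q ^ 2 + q"
    using card_plane_coloring[OF assms(4) char3 c fin] by simp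
  have "balanced_upper_chromatic_number (plane_points f) (plane_lines f) = ?N"
    unfolding balanced_upper_chromatic_number_def
  proof (rule Greatest_equality)
    note part = partition_on_plane_coloring[OF assms(4) char3 c]
    show "\<exists>P. strict_coloring (plane_points f) ?N P \<and> proper_coloring (plane_lines f) P
        \<and> balanced_coloring P"
      using part finite_elements[OF fin part] balanced_plane_coloring[OF assms(4) char3 c]
        proper_plane_coloring[OF assms(4) char3 c]
      unfolding strict_coloring_def by blast
  next
    fix N assume "\<exists>P. strict_coloring (plane_points f) N P \<and> proper_coloring (plane_lines f) P
        \<and> balanced_coloring P"
    then obtain P where P: "partition_on (plane_points f) P" "card P = N"
      "proper_coloring (plane_lines f) P" "balanced_coloring P"
      by (auto simp: strict_coloring_def)
    have "3 * card P \<le> card (plane_points f)"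
      by (rule card_balanced_proper_coloring_le[OF fin plane_lines_linear[OF assms(4)] _ P(1,3,4)])
         (simp_all add: card_plane_points card_plane_lines assms(4))
    \<comment> \<open>Here \<open>3 * N \<le> 3 * ?N + 1\<close>, and the surplus 1 is lost in
      dividing by 3.\<close>
    then show "N \<le> ?N" using N points P(2) by simp
  qed
  moreover have "real (q ^ 2 + q) / 3 = real ?N"
    using arg_cong[OF N, of real] by simp
  moreover have "\<lfloor>real (q ^ 2 + q + 1) / 3\<rfloor> = int ?N"
    by (rule floor_unique) (use arg_cong[OF N, of real] in auto)
  ultimately show ?thesis by simp
qed

end
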